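(* For every integer $n\ge1$, the $n$-agent disk inspection problem admits feasible trajectories for the $n$ agents whose average-case inspection time $\mathbb E_P[\mathrm{insp}(P)]$ is at most $3.5509015$ if $n=1$, at most $1.7946051$ if $n=2$, and at most $$\frac{n}{2\pi}\log\left(\frac{1+\sin(\pi/n)}{1-\sin(\pi/n)}\right)$$ if $n\ge 3$.
   Context: Let $D$ be the closed unit disk centered at the origin $O$ of $\mathbb R^2$, with boundary points $\mathcal P_t=(\cos t,\sin t)$, $t\in[0,2\pi]$. An agent located at a point $A$ inspects a boundary point $P$ if no convex combination of $A$ and $P$ lies in the interior of $D$. In the $n$-agent disk inspection problem, $n$ unit-speed agents all start at $O$ and move freely in the plane (each agent follows a continuous path starting at $O$ that is $1$-Lipschitz in time). The inspection time $\mathrm{insp}(P)$ of a boundary point $P$ is the first time at which some agent is at a point that inspects $P$. A collection of trajectories is feasible if every boundary point is inspected. Its average-case inspection time is $\mathbb E_P[\mathrm{insp}(P)]=\frac{1}{2\pi}\int_0^{2\pi}\mathrm{insp}(\mathcal P_t)\,dt$, i.e. the expectation over a uniformly random boundary point. *)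

theory Defs
  imports "HOL-Analysis.Analysis"
begin

type_synonym plane = "real \<times> real"

definition unit_disk :: "plane set" where
  "unit_disk = cball 0 1"

definition bpoint :: "real \<Rightarrow> plane" where
  "bpoint t = (cos t, sin t)"

definition inspects :: "plane \<Rightarrow> plane \<Rightarrow> bool" where
  "inspects A P \<longleftrightarrow> closed_segment A P \<inter> interior unit_disk = {}"

text \<open>Agents are numbered \<open>0, \<dots>, n - 1\<close>, and \<open>T i s\<close> is the position of agent \<open>i\<close> at time \<open>s \<ge> 0\<close>;
  all other values of \<open>T\<close> are irrelevant.\<close>

definition trajectories :: "nat \<Rightarrow> (nat \<Rightarrow> real \<Rightarrow> plane) \<Rightarrow> bool" where
  "trajectories n T \<longleftrightarrow> (\<forall>i<n. T i 0 = 0 \<and> 1-lipschitz_on {0..} (T i))"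

definition inspection_times :: "nat \<Rightarrow> (nat \<Rightarrow> real \<Rightarrow> plane) \<Rightarrow> plane \<Rightarrow> real set" where
  "inspection_times n T P = {s. 0 \<le> s \<and> (\<exists>i<n. inspects (T i s) P)}"

definition feasible :: "nat \<Rightarrow> (nat \<Rightarrow> real \<Rightarrow> plane) \<Rightarrow> bool" where
  "feasible n T \<longleftrightarrow> (\<forall>P \<in> frontier unit_disk. inspection_times n T P \<noteq> {})"

text \<open>For a boundary point \<open>P\<close> the positions inspecting \<open>P\<close> form a closed half-plane, so for
  continuous feasible trajectories the infimum is attained and is the first inspection time.
  The value is meaningful only if \<open>P\<close> is inspected at some time.\<close>

definition insp :: "nat \<Rightarrow> (nat \<Rightarrow> real \<Rightarrow> plane) \<Rightarrow> plane \<Rightarrow> real" where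
  "insp n T P = Inf (inspection_times n T P)"

text \<open>Meaningful only if the integrand is integrable on \<open>{0..2 * pi}\<close>; since the integral is \<open>0\<close>
  otherwise, integrability has to be demanded alongside any upper bound.\<close>

definition avg_insp :: "nat \<Rightarrow> (nat \<Rightarrow> real \<Rightarrow> plane) \<Rightarrow> real" where
  "avg_insp n T = 1 / (2 * pi) * integral {0..2 * pi} (\<lambda>t. insp n T (bpoint t))"

end

theory Submission
  imports Defs
begin

text \<open>
  A position \<open>A\<close> inspects the boundary point \<open>u\<close> iff \<open>A \<bullet> u \<ge> 1\<close>. By rotational symmetry it suffices
  to describe how one agent inspects an arc of length \<open>2\<pi>/n\<close>. Moving straight in the direction of the
  midpoint of an arc \<open>[0, 2a]\<close>, it inspects the points at angular distance \<open>\<theta>\<close> from that midpoint at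
  time \<open>1 / cos \<theta>\<close>; with \<open>a = \<pi>/n\<close> this is the bound for \<open>n \<ge> 3\<close>. For \<open>n \<le> 2\<close> the agent stops the
  radial motion at a smaller \<open>a\<close> and then slides along the tangents \<open>x \<mapsto> u x - y x *\<^sub>R u' x\<close> of the
  points still to be inspected. Its speed with respect to the angle \<open>x\<close> is \<open>sqrt ((1 - y')\<^sup>2 + y\<^sup>2)\<close>;
  for piecewise linear \<open>y\<close> this is at most a piecewise linear function with rational data,
  which gives an explicit rational bound for the integral of the inspection times.
\<close>


section \<open>Inspection as a half-plane condition\<close>

lemma inner_bpoint: "(x, y) \<bullet> bpoint t = x * cos t + y * sin t"
  by (simp add: bpoint_def)

lemma norm_bpoint [simp]: "norm (bpoint t) = 1"
  by (simp add: bpoint_def norm_Pair)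

text \<open>The boundary of the half-plane is the tangent at \<open>bpoint t\<close>. From below it,
  a short step from \<open>bpoint t\<close> towards \<open>A\<close> enters the open disk. From on
  or beyond it, the whole segment keeps inner product at least 1 with \<open>bpoint t\<close>, so by
  Cauchy-Schwarz its points have norm at least 1.\<close>

lemma inspects_bpoint_iff: "inspects A (bpoint t) \<longleftrightarrow> 1 \<le> A \<bullet> bpoint t"
proof
  let ?P = "bpoint t"
  assume "inspects A ?P"
  then have out: "1 \<le> norm X" if "X \<in> closed_segment A ?P" for X
    using that by (force simp: inspects_def unit_disk_def interior_cball disjoint_iff
        simp del: split_paired_All)
  show "1 \<le> A \<bullet> ?P"
  proof (rule ccontr)
    assume "\<not> 1 \<le> A \<bullet> ?P"
    then have neg: "A \<bullet> ?P < 1" by simp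
    define d where "d = (norm (A - ?P))\<^sup>2"
    \<comment> \<open>The step length makes \<open>k * d\<close> at most
      \<open>1 - A \<bullet> ?P\<close>, so in the squared norm the quadratic term is beaten by the
      linear one.\<close>
    define k where "k = min 1 ((1 - A \<bullet> ?P) / (1 + d))"
    have "0 \<le> d" by (simp add: d_def)
    have k: "0 < k" "k \<le> 1" using neg \<open>0 \<le> d\<close> by (auto simp: k_def)
    have "k \<le> (1 - A \<bullet> ?P) / (1 + d)" by (simp add: k_def)
    then have kd: "k * (1 + d) \<le> 1 - A \<bullet> ?P" using \<open>0 \<le> d\<close> by (simp add: pos_le_divide_eq)
    have PP: "?P \<bullet> ?P = 1" by (simp flip: power2_norm_eq_inner)
    have "(norm (?P + k *\<^sub>R (A - ?P)))\<^sup>2 = 1 + 2 * k * (A \<bullet> ?P - 1) + k\<^sup>2 * d"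
      unfolding d_def power2_norm_eq_inner
      by (simp add: inner_add_left inner_add_right inner_diff_left inner_diff_right PP
          inner_commute power2_eq_square algebra_simps)
    also have "\<dots> = 1 + k * (2 * (A \<bullet> ?P - 1) + k * d)"
      by (simp add: algebra_simps power2_eq_square)
    also have "\<dots> < 1"
    proof -
      have "k * (1 + d) = k + k * d" by (simp add: algebra_simps)
      then have "2 * (A \<bullet> ?P - 1) + k * d < 0"
        using k kd neg by (smt (verit))
      then show ?thesis using k(1) by (simp add: mult_pos_neg)
    qed
    finally have "norm (?P + k *\<^sub>R (A - ?P)) < 1"
      by (simp add: power_less_one_iff abs_square_less_1)
    moreover have "?P + k *\<^sub>R (A - ?P) \<in> closed_segment A ?P"
      using k by (subst closed_segment_commute) (auto simp: closed_segment_def algebra_simps intro!: exI[of _ k])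
    ultimately show False using out by fastforce
  qed
next
  let ?P = "bpoint t"
  assume A: "1 \<le> A \<bullet> ?P"
  have "1 \<le> norm X" if X: "X \<in> closed_segment A ?P" for X
  proof -
    obtain k where k: "0 \<le> k" "k \<le> 1" "X = (1 - k) *\<^sub>R A + k *\<^sub>R ?P"
      using X by (auto simp: closed_segment_def)
    have "?P \<bullet> ?P = 1" by (simp flip: power2_norm_eq_inner)
    then have "X \<bullet> ?P = (1 - k) * (A \<bullet> ?P) + k"
      by (simp add: k(3) inner_add_left)
    also have "\<dots> \<ge> (1 - k) * 1 + k"
      using A k by (intro add_right_mono mult_left_mono) auto
    finally have "1 \<le> X \<bullet> ?P" by simp
    also have "\<dots> \<le> norm X * norm ?P" by (rule norm_cauchy_schwarz)
    finally show ?thesis by simp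
  qed
  then show "inspects A ?P"
    by (fastforce simp: inspects_def unit_disk_def interior_cball disjoint_iff)
qed

lemma frontier_unit_disk: "frontier unit_disk = bpoint ` {0..2 * pi}"
proof -
  have "\<exists>t\<in>{0..2 * pi}. P = bpoint t" if "norm P = 1" for P :: plane
  proof -
    obtain x y where P: "P = (x, y)" by fastforce
    have "x\<^sup>2 + y\<^sup>2 = 1" using that by (simp add: P norm_Pair)
    then obtain t where "0 \<le> t" "t < 2 * pi" "x = cos t" "y = sin t"
      by (rule sincos_total_2pi)
    then show ?thesis by (intro bexI[of _ t]) (auto simp: P bpoint_def)
  qed
  then show ?thesis
    by (auto simp: unit_disk_def image_iff)
qed

lemma continuous_on_bpoint [continuous_intros]:
  fixes f :: "'a::t2_space \<Rightarrow> real"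
  shows "continuous_on S f \<Longrightarrow> continuous_on S (\<lambda>x. bpoint (f x))"
  unfolding bpoint_def by (intro continuous_intros)


section \<open>First inspection times: attainment, measurability, integrability\<close>

lemma trajectory_continuous_on:
  assumes "trajectories n T" "i < n" "S \<subseteq> {0..}"
  shows "continuous_on S (T i)"
  using assms lipschitz_on_continuous_on continuous_on_subset unfolding trajectories_def by blast

text \<open>Continuity makes the set of inspection times closed, so its infimum is attained. This
  yields both upper bounds on \<open>insp\<close> and a usable form of its sublevel sets.\<close>

lemma insp_le_iff:
  assumes tr: "trajectories n T" and fe: "feasible n T" and t: "t \<in> {0..2 * pi}"
  shows "insp n T (bpoint t) \<le> c \<longleftrightarrow> (\<exists>s\<in>{0..c}. \<exists>i<n. 1 \<le> T i s \<bullet> bpoint t)"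
proof -
  let ?S = "inspection_times n T (bpoint t)"
  have S_eq: "?S = (\<Union>i\<in>{..<n}. {s \<in> {0..}. 1 \<le> T i s \<bullet> bpoint t})"
    by (auto simp: inspection_times_def inspects_bpoint_iff)
  have "closed {s \<in> {0..}. 1 \<le> T i s \<bullet> bpoint t}" if "i < n" for i
    by (intro continuous_closed_preimage_constant continuous_on_closed_Collect_le
        continuous_intros trajectory_continuous_on[OF tr that]) auto
  then have cl: "closed ?S" unfolding S_eq by (intro closed_UN) auto
  have ne: "?S \<noteq> {}" using fe t by (auto simp: feasible_def frontier_unit_disk)
  have bb: "bdd_below ?S" by (auto simp: inspection_times_def bdd_below_def)
  have mem: "insp n T (bpoint t) \<in> ?S"
    unfolding insp_def by (rule closed_contains_Inf[OF ne bb cl])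
  have "insp n T (bpoint t) \<le> s" if "s \<in> ?S" for s
    unfolding insp_def by (rule cInf_lower[OF that bb])
  then show ?thesis using mem by (fastforce simp: S_eq)
qed

lemma insp_nonneg:
  assumes "feasible n T" and "t \<in> {0..2 * pi}"
  shows "0 \<le> insp n T (bpoint t)"
  unfolding insp_def
  using assms by (intro cInf_greatest) (auto simp: feasible_def frontier_unit_disk inspection_times_def)

text \<open>Each sublevel set is a finite union of projections of compact sets of pairs (angle,
  time), hence closed.\<close>

lemma insp_measurable:
  assumes tr: "trajectories n T" and fe: "feasible n T"
  shows "(\<lambda>t. insp n T (bpoint t)) \<in> borel_measurable (lebesgue_on {0..2 * pi})"
  unfolding borel_measurable_iff_le
proof (intro allI)
  fix c
  define K where "K i = {z \<in> {0..2 * pi} \<times> {0..c}. 1 \<le> T i (snd z) \<bullet> bpoint (fst z)}" for i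
  have "compact (K i)" if "i < n" for i
  proof -
    have "continuous_on ({0..2 * pi} \<times> {0..c}) (\<lambda>z. T i (snd z) \<bullet> bpoint (fst z))"
      by (intro continuous_intros continuous_on_compose2[OF trajectory_continuous_on[OF tr that order_refl]]) auto
    then have "closed (K i)"
      unfolding K_def by (intro continuous_on_closed_Collect_le continuous_on_const closed_Times) auto
    moreover have "bounded (K i)"
      by (rule bounded_subset[of "{0..2 * pi} \<times> {0..c}"]) (auto simp: K_def intro!: bounded_Times)
    ultimately show ?thesis by (simp add: compact_eq_bounded_closed)
  qed
  then have "closed (\<Union>i\<in>{..<n}. fst ` K i)"
    by (intro closed_UN) (auto intro!: compact_imp_closed compact_continuous_image continuous_intros)
  moreover have eq: "{t \<in> {0..2 * pi}. insp n T (bpoint t) \<le> c} = (\<Union>i\<in>{..<n}. fst ` K i)"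
  proof (rule set_eqI)
    fix t
    have "t \<in> (\<Union>i\<in>{..<n}. fst ` K i)
        \<longleftrightarrow> t \<in> {0..2 * pi} \<and> (\<exists>s\<in>{0..c}. \<exists>i<n. 1 \<le> T i s \<bullet> bpoint t)"
      by (auto simp: K_def image_iff) blast+
    then show "t \<in> {t \<in> {0..2 * pi}. insp n T (bpoint t) \<le> c} \<longleftrightarrow> t \<in> (\<Union>i\<in>{..<n}. fst ` K i)"
      using insp_le_iff[OF tr fe, of t c] by blast
  qed
  ultimately have "{t \<in> {0..2 * pi}. insp n T (bpoint t) \<le> c} \<in> sets lebesgue"
    by (simp add: lebesgue_closedin borel_closed)
  then show "{t \<in> space (lebesgue_on {0..2 * pi}). insp n T (bpoint t) \<le> c} \<in> sets (lebesgue_on {0..2 * pi})"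
    by (subst sets_restrict_space_iff) auto
qed

lemma insp_integrable:
  assumes tr: "trajectories n T" and fe: "feasible n T"
    and le: "\<And>t. t \<in> {0..2 * pi} \<Longrightarrow> insp n T (bpoint t) \<le> s"
  shows "(\<lambda>t. insp n T (bpoint t)) integrable_on {0..2 * pi}"
proof (rule measurable_bounded_by_integrable_imp_integrable_real)
  show "(\<lambda>_. s) integrable_on {0..2 * pi}" by (intro integrable_continuous_interval continuous_intros)
qed (use insp_measurable[OF tr fe] insp_nonneg[OF fe] le in auto)

section \<open>Rotated copies of a single agent's sweep\<close>

definition rotation :: "real \<Rightarrow> plane \<Rightarrow> plane" where
  "rotation \<theta> A = (cos \<theta> * fst A - sin \<theta> * snd A, sin \<theta> * fst A + cos \<theta> * snd A)"

lemma rotation_0 [simp]: "rotation \<theta> 0 = 0"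
  by (simp add: rotation_def zero_prod_def)

lemma dist_rotation [simp]: "dist (rotation \<theta> A) (rotation \<theta> B) = dist A B"
proof -
  obtain a b c d where AB: "A = (a, b)" "B = (c, d)" by fastforce
  define x where "x = a - c"
  define y where "y = b - d"
  have "(cos \<theta> * x - sin \<theta> * y)\<^sup>2 + (sin \<theta> * x + cos \<theta> * y)\<^sup>2
      = ((sin \<theta>)\<^sup>2 + (cos \<theta>)\<^sup>2) * (x\<^sup>2 + y\<^sup>2)"
    by (simp add: power2_eq_square algebra_simps del: sin_cos_squared_add sin_cos_squared_add2 sin_cos_squared_add3)
  moreover have "rotation \<theta> A - rotation \<theta> B = (cos \<theta> * x - sin \<theta> * y, sin \<theta> * x + cos \<theta> * y)"
    by (simp add: rotation_def AB x_def y_def algebra_simps)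
  ultimately show ?thesis
    by (simp add: dist_norm norm_Pair AB x_def y_def)
qed

lemma inner_rotation_bpoint: "rotation \<theta> A \<bullet> bpoint (t + \<theta>) = A \<bullet> bpoint t"
proof -
  obtain a b where A: "A = (a, b)" by fastforce
  have "rotation \<theta> A \<bullet> bpoint (t + \<theta>)
      = ((sin \<theta>)\<^sup>2 + (cos \<theta>)\<^sup>2) * (a * cos t + b * sin t)"
    by (simp add: rotation_def A inner_bpoint cos_add sin_add power2_eq_square algebra_simps
        del: sin_cos_squared_add sin_cos_squared_add2 sin_cos_squared_add3)
  then show ?thesis by (simp add: A inner_bpoint)
qed

text \<open>For an agent circling counterclockwise, \<open>y\<close> is the distance left to the point of tangency.\<close>

definition tangent_point :: "real \<Rightarrow> real \<Rightarrow> plane" where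
  "tangent_point t y = (cos t + y * sin t, sin t - y * cos t)"

lemma tangent_point_inner [simp]: "tangent_point t y \<bullet> bpoint t = 1"
proof -
  have "tangent_point t y \<bullet> bpoint t = (sin t)\<^sup>2 + (cos t)\<^sup>2"
    by (simp add: tangent_point_def inner_bpoint power2_eq_square algebra_simps)
  then show ?thesis by simp
qed

text \<open>\<open>f x\<close> is some time at which \<open>p\<close> inspects the angle
  \<open>x\<close>, not necessarily the first, so \<open>c\<close> is an upper bound for the
  integral of the first inspection times over the arc. Fixing the end point on the tangent at
  \<open>t\<close> allows the path to be extended.\<close>

definition sweeps :: "real \<Rightarrow> real \<Rightarrow> real \<Rightarrow> real \<Rightarrow> bool" where
  "sweeps t y s c \<longleftrightarrow> 0 \<le> t \<and> 0 \<le> s \<and> (\<exists>p f. p 0 = 0 \<and> 1-lipschitz_on {0..s} p \<and> p s = tangent_point t y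
     \<and> (\<forall>x\<in>{0..t}. 0 \<le> f x \<and> f x \<le> s \<and> 1 \<le> p (f x) \<bullet> bpoint x)
     \<and> (f has_integral c) {0..t})"

text \<open>Agent \<open>i\<close> follows the path rotated by \<open>i\<close> sectors of length
  \<open>2 * pi / real n\<close>. The swept arc may overshoot the sector: as \<open>f\<close> is
  nonnegative, cutting it off only lowers the integral. This lets the swept angle be matched to a
  sector by an inequality only.\<close>

lemma sweeps_trajectories:
  assumes n: "n \<ge> 1" and t: "2 * pi / real n \<le> t" and sw: "sweeps t y s c"
  shows "\<exists>T. trajectories n T \<and> feasible n T
      \<and> (\<lambda>t. insp n T (bpoint t)) integrable_on {0..2 * pi} \<and> avg_insp n T \<le> real n / (2 * pi) * c"
proof -
  from sw obtain p f where s: "0 \<le> s" and p0: "p 0 = 0" and lip: "1-lipschitz_on {0..s} p"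
    and f: "\<And>x. x \<in> {0..t} \<Longrightarrow> 0 \<le> f x \<and> f x \<le> s \<and> 1 \<le> p (f x) \<bullet> bpoint x"
    and fi: "(f has_integral c) {0..t}"
    unfolding sweeps_def by blast
  define L where "L = 2 * pi / real n"
  have L: "0 < L" "L \<le> t" "real n * L = 2 * pi" using n t by (auto simp: L_def)
  \<comment> \<open>The \<open>min\<close> lets an agent rest once its sweep is over, which keeps
    the path Lipschitz for all times.\<close>
  define T where "T = (\<lambda>i r. rotation (real i * L) (p (min r s)))"
  have lipT: "1-lipschitz_on {0..} (T i)" for i
  proof (rule lipschitz_onI)
    fix x y :: real assume "x \<in> {0..}" "y \<in> {0..}"
    then have "dist (p (min x s)) (p (min y s)) \<le> 1 * dist (min x s) (min y s)"
      using s by (intro lipschitz_onD[OF lip]) auto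
    also have "\<dots> \<le> 1 * dist x y" by (auto simp: dist_real_def min_def)
    finally show "dist (T i x) (T i y) \<le> 1 * dist x y" by (simp add: T_def)
  qed simp
  then have tr: "trajectories n T" using p0 s by (simp add: trajectories_def T_def)
  have ins: "0 \<le> f (x - real i * L) \<and> f (x - real i * L) \<le> s
      \<and> 1 \<le> T i (f (x - real i * L)) \<bullet> bpoint x"
    if "x \<in> {real i * L..real (Suc i) * L}" for i x
  proof -
    have "x - real i * L \<in> {0..t}" using that L by (auto simp: algebra_simps)
    then show ?thesis
      using f[of "x - real i * L"] inner_rotation_bpoint[of "real i * L" _ "x - real i * L"]
      by (simp add: T_def min_absorb1)
  qed
  have sector: "\<exists>i<n. x \<in> {real i * L..real (Suc i) * L}" if x: "x \<in> {0..2 * pi}" for x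
  proof (cases "x = 2 * pi")
    case True
    \<comment> \<open>At \<open>2 * pi\<close> the floor used below would give the index
      \<open>n\<close>; the point is the right end of the last sector.\<close>
    then show ?thesis using n L by (intro exI[of _ "n - 1"]) (auto simp: of_nat_diff algebra_simps)
  next
    case False
    define i where "i = nat \<lfloor>x / L\<rfloor>"
    have ri: "real i = of_int \<lfloor>x / L\<rfloor>" using x L by (simp add: i_def)
    have "real i \<le> x / L" "x / L < real i + 1" unfolding ri by linarith+
    then have i: "real i * L \<le> x" "x < real (Suc i) * L" using L by (auto simp: field_simps)
    have "real i * L < real n * L" using i(1) False x L(3) by auto
    then have "i < n" using L(1) by simp
    then show ?thesis using i by auto
  qed
  have fe: "feasible n T"
    unfolding feasible_def
  proof
    fix P assume "P \<in> frontier unit_disk"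
    then obtain x where x: "x \<in> {0..2 * pi}" "P = bpoint x" by (auto simp: frontier_unit_disk)
    from sector[OF x(1)] obtain i where "i < n" "x \<in> {real i * L..real (Suc i) * L}" by blast
    with ins[OF this(2)] show "inspection_times n T P \<noteq> {}"
      unfolding x(2) inspection_times_def inspects_bpoint_iff by blast
  qed
  have le: "insp n T (bpoint x) \<le> f (x - real i * L)"
    if "x \<in> {real i * L..real (Suc i) * L}" "i < n" for x i
  proof -
    have "0 \<le> real i * L" using L(1) by simp
    moreover have "real (Suc i) * L \<le> real n * L"
      using L(1) that(2) by (intro mult_right_mono) auto
    ultimately have "x \<in> {0..2 * pi}" using that(1) L(3) by auto
    then show ?thesis using ins[OF that(1)] that(2)
      by (subst insp_le_iff[OF tr fe]) auto
  qed
  let ?g = "\<lambda>t. insp n T (bpoint t)"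
  have int: "?g integrable_on {0..2 * pi}"
    using insp_integrable[OF tr fe, of s] sector le ins by (meson order_trans)
  have sub: "{0..real n * L} = {0..2 * pi}" by (simp add: L)
  \<comment> \<open>The sectors are added one at a time; on each, \<open>insp\<close> is dominated
    by a translate of \<open>f\<close>.\<close>
  have "integral {0..real m * L} ?g \<le> real m * c" if "m \<le> n" for m
    using that
  proof (induction m)
    case (Suc m)
    have mono: "real (Suc m) * L \<le> real n * L" using Suc.prems L(1) by (intro mult_right_mono) auto
    have mL: "0 \<le> real m * L" "real m * L \<le> real (Suc m) * L" using L(1) by (auto simp: mult_right_mono)
    have i1: "?g integrable_on {0..real (Suc m) * L}"
      by (rule integrable_on_subinterval[OF int]) (use mono L(3) in auto)
    have i2: "?g integrable_on {real m * L..real (Suc m) * L}"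
      by (rule integrable_on_subinterval[OF int]) (use mono mL L(3) in auto)
    have fL: "f integrable_on {0..L}"
      by (rule integrable_on_subinterval[of _ "{0..t}"]) (use fi L in \<open>auto intro: has_integral_integrable\<close>)
    have "integral {0..L} f \<le> integral {0..t} f"
      by (rule integral_subset_le) (use L fi fL f in \<open>auto intro: has_integral_integrable\<close>)
    then have fc: "integral {0..L} f \<le> c" using fi by (simp add: integral_unique)
    have sh: "((\<lambda>x. f (x - real m * L)) has_integral integral {0..L} f) {real m * L..real (Suc m) * L}"
    proof -
      have "(f has_integral integral {0..L} f) (cbox 0 L)" using fL by (simp add: integrable_integral)
      from has_integral_affinity[OF this, of 1 "- (real m * L)"]
      show ?thesis by (simp add: algebra_simps)
    qed
    have "integral {real m * L..real (Suc m) * L} ?g \<le> integral {0..L} f"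
      by (rule has_integral_le[OF integrable_integral[OF i2] sh]) (use le Suc.prems in auto)
    moreover have "integral {0..real (Suc m) * L} ?g
        = integral {0..real m * L} ?g + integral {real m * L..real (Suc m) * L} ?g"
      using Henstock_Kurzweil_Integration.integral_combine[OF mL i1] by simp
    ultimately show ?case using Suc fc by (simp add: algebra_simps)
  qed simp
  from this[of n] have "integral {0..2 * pi} ?g \<le> real n * c" by (simp add: sub)
  then have "avg_insp n T \<le> real n / (2 * pi) * c"
    by (simp add: avg_insp_def field_simps)
  then show ?thesis using tr fe int by blast
qed


section \<open>Building sweeps: radial start and tangential steps\<close>

text \<open>Turns a curve parametrized by angle into one parametrized by time, with \<open>F\<close>
  as the clock. Any preimage under \<open>F\<close> will do, because equal times force equal
  positions.\<close>

lemma lipschitz_reparametrization: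
  fixes A :: "real \<Rightarrow> 'a::metric_space" and F :: "real \<Rightarrow> real"
  assumes ab: "a \<le> b" and cont: "continuous_on {a..b} F"
    and AF: "\<And>x y. x \<in> {a..b} \<Longrightarrow> y \<in> {a..b} \<Longrightarrow> dist (A x) (A y) \<le> dist (F x) (F y)"
  obtains q where "1-lipschitz_on {F a..F b} q" "\<And>x. x \<in> {a..b} \<Longrightarrow> q (F x) = A x"
proof
  define g where "g s = (SOME x. x \<in> {a..b} \<and> F x = s)" for s
  have g: "g s \<in> {a..b} \<and> F (g s) = s" if "\<exists>x. x \<in> {a..b} \<and> F x = s" for s
    unfolding g_def using that by (rule someI_ex)
  show "A (g (F x)) = A x" if "x \<in> {a..b}" for x
    using AF[of "g (F x)" x] g[of "F x"] that by (metis dist_self dist_le_zero_iff)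
  show "1-lipschitz_on {F a..F b} (\<lambda>s. A (g s))"
  proof (rule lipschitz_onI)
    have ex: "\<exists>x. x \<in> {a..b} \<and> F x = s" if "s \<in> {F a..F b}" for s
      using IVT'[of F a s b] that ab cont by auto
    fix s r assume "s \<in> {F a..F b}" "r \<in> {F a..F b}"
    then show "dist (A (g s)) (A (g r)) \<le> 1 * dist s r"
      using AF[of "g s" "g r"] g[OF ex[of s]] g[OF ex[of r]] by simp
  qed simp
qed

text \<open>At time \<open>s\<close> the inner product with \<open>bpoint x\<close> is
  \<open>s * cos (x - a)\<close>, so the angle \<open>x\<close> is inspected at time
  \<open>1 / cos (x - a)\<close>, and the cost is an integral of the secant. The end point is the
  intersection of the tangents at \<open>0\<close> and \<open>2 * a\<close>.\<close>

lemma sweeps_radial: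
  assumes a: "0 \<le> a" "a < pi / 2"
  shows "sweeps (2 * a) (tan a) (1 / cos a) (ln ((1 + sin a) / (1 - sin a)))"
proof -
  have ca: "0 < cos a" using a by (intro cos_gt_zero_pi) auto
  define p where "p s = s *\<^sub>R bpoint a" for s :: real
  define f where "f x = 1 / cos (x - a)" for x
  have cx: "0 < cos (x - a)" if "x \<in> {0..2 * a}" for x
    using that a by (intro cos_gt_zero_pi) auto
  have sx: "\<bar>sin (x - a)\<bar> < 1" if "x \<in> {0..2 * a}" for x
  proof -
    have "(sin (x - a))\<^sup>2 < 1"
      using cx[OF that] sin_cos_squared_add[of "x - a"] by (smt (verit) zero_less_power)
    then show ?thesis by (simp add: abs_square_less_1)
  qed
  have "1-lipschitz_on {0..1 / cos a} p"
    by (rule lipschitz_onI) (auto simp: p_def dist_norm simp flip: scaleR_diff_left)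
  moreover have "p (1 / cos a) = tangent_point (2 * a) (tan a)"
  proof -
    have "cos (2 * a) * cos a + sin a * sin (2 * a) = cos a"
      using cos_diff[of "2 * a" a] by (simp add: algebra_simps)
    moreover have "sin (2 * a) * cos a - sin a * cos (2 * a) = sin a"
      using sin_diff[of "2 * a" a] by (simp add: algebra_simps)
    ultimately show ?thesis
      using ca by (simp add: p_def bpoint_def tangent_point_def tan_def field_simps)
  qed
  moreover have "0 \<le> f x \<and> f x \<le> 1 / cos a \<and> 1 \<le> p (f x) \<bullet> bpoint x" if x: "x \<in> {0..2 * a}" for x
  proof -
    have "cos a \<le> cos \<bar>x - a\<bar>" using x a by (intro cos_monotone_0_pi_le) auto
    then have "cos a \<le> cos (x - a)" by simp
    moreover have "bpoint a \<bullet> bpoint x = cos (x - a)"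
      by (simp add: bpoint_def cos_diff algebra_simps)
    ultimately show ?thesis
      using cx[OF x] ca by (simp add: f_def p_def frac_le)
  qed
  moreover have "(f has_integral ln ((1 + sin a) / (1 - sin a))) {0..2 * a}"
  proof -
    define G where "G x = (ln (1 + sin (x - a)) - ln (1 - sin (x - a))) / 2" for x
    have "(f has_integral (G (2 * a) - G 0)) {0..2 * a}"
    proof (rule fundamental_theorem_of_calculus)
      fix x assume x: "x \<in> {0..2 * a}"
      have "cos (x - a) / (1 + sin (x - a)) + cos (x - a) / (1 - sin (x - a)) = 2 / cos (x - a)"
      proof -
        have sq: "(cos (x - a))\<^sup>2 = (1 + sin (x - a)) * (1 - sin (x - a))"
          by (simp add: cos_squared_eq power2_eq_square algebra_simps)
        have "cos (x - a) / (1 + sin (x - a)) + cos (x - a) / (1 - sin (x - a))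
            = 2 * cos (x - a) / (cos (x - a))\<^sup>2"
          unfolding sq using sx[OF x] by (subst add_frac_eq) (auto simp: abs_less_iff algebra_simps)
        then show ?thesis using cx[OF x] by (simp add: power2_eq_square)
      qed
      then have "(G has_real_derivative f x) (at x within {0..2 * a})"
        unfolding G_def f_def using sx[OF x]
        by (auto intro!: derivative_eq_intros)
      then show "(G has_vector_derivative f x) (at x within {0..2 * a})"
        by (simp add: has_real_derivative_iff_has_vector_derivative)
    qed (use a in auto)
    moreover have "G (2 * a) - G 0 = ln ((1 + sin a) / (1 - sin a))"
      using sx[of 0] a by (simp add: G_def ln_div abs_less_iff field_simps)
    ultimately show ?thesis by simp
  qed
  ultimately show ?thesis
    unfolding sweeps_def using a ca by (intro conjI exI[of _ p] exI[of _ f]) (auto simp: p_def)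
qed

text \<open>The agent stays on the tangent at the point being inspected, at a distance from the point
  of tangency that varies linearly with its angle. As the speed this requires per unit of angle is
  convex in the angle, it is at most the linear interpolation between \<open>w\<close> and \<open>w'\<close>.\<close>

lemma sweeps_step:
  assumes sw: "sweeps t y s c" and d: "0 < d" and w: "0 \<le> w" "0 \<le> w'"
    and lo: "(1 - (y' - y) / d)\<^sup>2 + y\<^sup>2 \<le> w\<^sup>2" and hi: "(1 - (y' - y) / d)\<^sup>2 + y'\<^sup>2 \<le> w'\<^sup>2"
  shows "sweeps (t + d) y' (s + d * (w + w') / 2) (c + (d * s + d\<^sup>2 * (w / 3 + w' / 6)))"
proof -
  from sw obtain p f where t: "0 \<le> t" and s: "0 \<le> s" and p0: "p 0 = 0"
    and lip: "1-lipschitz_on {0..s} p" and ps: "p s = tangent_point t y"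
    and f: "\<And>x. x \<in> {0..t} \<Longrightarrow> 0 \<le> f x \<and> f x \<le> s \<and> 1 \<le> p (f x) \<bullet> bpoint x"
    and fi: "(f has_integral c) {0..t}"
    unfolding sweeps_def by blast
  \<comment> \<open>Here \<open>Y\<close> is the distance to the point of tangency, with slope
    \<open>m\<close>; \<open>W\<close> is the linear speed bound, \<open>F\<close> its integral and
    thus the inspection time of the angle \<open>x\<close>, and \<open>A\<close> the position with
    derivative \<open>A'\<close>.\<close>
  define m where "m = (y' - y) / d"
  define Y where "Y x = y + m * (x - t)" for x
  define W where "W x = w + (w' - w) * (x - t) / d" for x
  define F where "F x = s + w * (x - t) + (w' - w) * (x - t)\<^sup>2 / (2 * d)" for x
  define A where "A x = tangent_point x (Y x)" for x
  define A' where "A' x = (- (1 - m) * sin x + Y x * cos x, (1 - m) * cos x + Y x * sin x)" for x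
  have dA: "(A has_vector_derivative A' x) (at x)" for x
    unfolding A_def A'_def tangent_point_def Y_def
    by (auto intro!: has_vector_derivative_Pair derivative_eq_intros
        simp: has_real_derivative_iff_has_vector_derivative[symmetric] algebra_simps)
  have dF: "(F has_real_derivative W x) (at x)" for x
    unfolding F_def W_def using d by (auto intro!: derivative_eq_intros simp: field_simps)
  have AW: "norm (A' x) \<le> W x" if x: "t \<le> x" "x \<le> t + d" for x
  proof -
    define k where "k = (x - t) / d"
    have k: "0 \<le> k" "k \<le> 1" "x = t + k * d" using x d by (auto simp: k_def)
    \<comment> \<open>In the orthonormal frame of \<open>bpoint x\<close> and its derivative,
      \<open>A' x\<close> has the coordinates \<open>Y x\<close> and \<open>1 - m\<close>.\<close>
    have "norm (A' x) = norm (1 - m, Y x)"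
    proof -
      have "(- (1 - m) * sin x + Y x * cos x)\<^sup>2 + ((1 - m) * cos x + Y x * sin x)\<^sup>2
         = ((sin x)\<^sup>2 + (cos x)\<^sup>2) * ((1 - m)\<^sup>2 + (Y x)\<^sup>2)"
        by (simp add: power2_eq_square algebra_simps
            del: sin_cos_squared_add sin_cos_squared_add2 sin_cos_squared_add3)
      then show ?thesis by (simp add: A'_def norm_Pair)
    qed
    also have "(1 - m, Y x) = (1 - k) *\<^sub>R (1 - m, y) + k *\<^sub>R (1 - m, y')"
      using d by (simp add: Y_def m_def k(3) field_simps)
    also have "norm \<dots> \<le> (1 - k) * norm (1 - m, y) + k * norm (1 - m, y')"
      using k norm_triangle_ineq[of "(1 - k) *\<^sub>R (1 - m, y)" "k *\<^sub>R (1 - m, y')"]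
      by (simp del: scaleR_Pair)
    also have "\<dots> \<le> (1 - k) * w + k * w'"
      using k w lo hi by (intro add_mono mult_left_mono) (auto simp: norm_Pair m_def intro!: real_le_lsqrt)
    also have "\<dots> = W x" using d by (simp add: W_def k(3) field_simps)
    finally show ?thesis .
  qed
  \<comment> \<open>Mean value inequality: the speed is at most the derivative \<open>W\<close> of
    \<open>F\<close>, so displacement is at most elapsed time. In particular \<open>F\<close> is
    monotone.\<close>
  have AF: "norm (A x - A z) \<le> F x - F z" if "t \<le> z" "z \<le> x" "x \<le> t + d" for x z
  proof (cases "z = x")
    case False
    show ?thesis
    proof (rule differentiable_bound_general)
      show "z < x" using False that by simp
      show "continuous_on {z..x} A"
        by (intro continuous_at_imp_continuous_on ballI has_vector_derivative_continuous[OF dA])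
      show "continuous_on {z..x} F"
        by (intro continuous_at_imp_continuous_on ballI DERIV_isCont[OF dF])
    qed (use AW dA dF that in \<open>auto simp: has_real_derivative_iff_has_vector_derivative\<close>)
  qed simp
  have Fmono: "F z \<le> F x" if "t \<le> z" "z \<le> x" "x \<le> t + d" for x z
    using AF[OF that] norm_ge_zero[of "A x - A z"] by linarith
  have Ft: "F t = s" and Fd: "F (t + d) = s + d * (w + w') / 2"
    using d by (simp_all add: F_def field_simps power2_eq_square)
  have "dist (A x) (A z) \<le> dist (F x) (F z)" if "x \<in> {t..t + d}" "z \<in> {t..t + d}" for x z
    using AF[of z x] AF[of x z] that
    by (cases "z \<le> x") (auto simp: dist_norm norm_minus_commute)
  moreover have "continuous_on {t..t + d} F"
    by (intro continuous_at_imp_continuous_on ballI DERIV_isCont[OF dF])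
  ultimately obtain q where q: "1-lipschitz_on {F t..F (t + d)} q"
    and qF: "\<And>x. x \<in> {t..t + d} \<Longrightarrow> q (F x) = A x"
    using lipschitz_reparametrization[of t "t + d" F A] d by auto
  have qs: "q s = p s" using qF[of t] d by (simp add: Ft ps A_def Y_def)
  define p' where "p' x = (if x \<le> s then p x else q x)" for x
  define f' where "f' x = (if x \<le> t then f x else F x)" for x
  let ?s = "s + d * (w + w') / 2"
  have "1-lipschitz_on {0..?s} p'"
    unfolding p'_def using lipschitz_on_concat[OF lip, of ?s q] q qs by (simp add: Ft Fd)
  moreover have p'F: "p' (F x) = A x" if "x \<in> {t..t + d}" for x
    using qF[OF that] qs Fmono[of t x] that by (auto simp: p'_def Ft)
  moreover have "0 \<le> f' x \<and> f' x \<le> ?s \<and> 1 \<le> p' (f' x) \<bullet> bpoint x" if x: "x \<in> {0..t + d}" for x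
  proof (cases "x \<le> t")
    case True
    have "0 \<le> d * (w + w')" using d w by simp
    then show ?thesis using f[of x] x True by (auto simp: f'_def p'_def)
  next
    case False
    then have x': "x \<in> {t..t + d}" using x by auto
    then show ?thesis
      using p'F[OF x'] Fmono[of t x] Fmono[of x "t + d"] False s
      by (simp add: f'_def Ft Fd A_def)
  qed
  moreover have "(f' has_integral (c + (d * s + d\<^sup>2 * (w / 3 + w' / 6)))) {0..t + d}"
  proof (rule has_integral_combine)
    show "(f' has_integral c) {0..t}"
      by (rule has_integral_eq[OF _ fi]) (simp add: f'_def)
    define G where "G x = s * (x - t) + w * (x - t)\<^sup>2 / 2 + (w' - w) * (x - t) ^ 3 / (6 * d)" for x
    have "(F has_integral (G (t + d) - G t)) {t..t + d}"
    proof (rule fundamental_theorem_of_calculus)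
      fix x
      have "(G has_real_derivative F x) (at x within {t..t + d})"
        unfolding G_def F_def using d by (auto intro!: derivative_eq_intros simp: field_simps power2_eq_square)
      then show "(G has_vector_derivative F x) (at x within {t..t + d})"
        by (simp add: has_real_derivative_iff_has_vector_derivative)
    qed (use d in simp)
    moreover have "G (t + d) - G t = d * s + d\<^sup>2 * (w / 3 + w' / 6)"
      using d by (simp add: G_def field_simps power2_eq_square power3_eq_cube)
    ultimately have "(F has_integral (d * s + d\<^sup>2 * (w / 3 + w' / 6))) {t..t + d}" by simp
    then show "(f' has_integral (d * s + d\<^sup>2 * (w / 3 + w' / 6))) {t..t + d}"
      \<comment> \<open>At \<open>t\<close> itself \<open>f'\<close> takes the value
        \<open>f t\<close>, which may differ from \<open>F t\<close>; one point does not affect the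
        integral.\<close>
      by (rule has_integral_spike_finite[of "{t}", rotated 2]) (auto simp: f'_def)
  qed (use t d in auto)
  moreover have "p' 0 = 0" using s p0 by (simp add: p'_def)
  moreover have "p' ?s = tangent_point (t + d) y'"
    using p'F[of "t + d"] d by (simp add: Fd A_def Y_def m_def)
  ultimately show ?thesis
    unfolding sweeps_def using t s d w
    by (intro conjI exI[of _ p'] exI[of _ f']) auto
qed

text \<open>An entry lists the angle of a step, the tangential distance after it, and the speed
  bounds at its two ends. The first argument is the distance before the step; the conditions are
  those of \<open>sweeps_step\<close>.\<close>

fun sweep_ok :: "real \<Rightarrow> (real \<times> real \<times> real \<times> real) list \<Rightarrow> bool" where
  "sweep_ok y [] \<longleftrightarrow> True"
| "sweep_ok y ((d, y', w, w') # ps) \<longleftrightarrow> 0 < d \<and> 0 \<le> w \<and> 0 \<le> w'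
     \<and> (1 - (y' - y) / d)\<^sup>2 + y\<^sup>2 \<le> w\<^sup>2 \<and> (1 - (y' - y) / d)\<^sup>2 + y'\<^sup>2 \<le> w'\<^sup>2 \<and> sweep_ok y' ps"

text \<open>The argument \<open>s\<close> is the time elapsed before the step; each summand is the
  cost added by \<open>sweeps_step\<close>.\<close>

fun sweep_cost :: "real \<Rightarrow> (real \<times> real \<times> real \<times> real) list \<Rightarrow> real" where
  "sweep_cost s [] = 0"
| "sweep_cost s ((d, y', w, w') # ps)
     = d * s + d\<^sup>2 * (w / 3 + w' / 6) + sweep_cost (s + d * (w + w') / 2) ps"

lemma sweeps_list:
  assumes "sweeps t y s c" "sweep_ok y ps"
  shows "\<exists>y' s'. sweeps (t + sum_list (map fst ps)) y' s' (c + sweep_cost s ps)"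
  using assms
proof (induction ps arbitrary: t y s c)
  case (Cons q ps)
  obtain d y' w w' where q: "q = (d, y', w, w')" by (cases q)
  show ?case
    using Cons.IH[OF sweeps_step[OF Cons.prems(1), of d w w' y']] Cons.prems(2)
    by (simp add: q add.assoc)
qed auto

section \<open>Rational data and numerical bounds for one and two agents\<close>

text \<open>The radial start for the right triangle with legs \<open>1\<close> and \<open>z\<close>
  and hypotenuse \<open>h\<close>. For a rational triangle the distance and time at its end are
  rational, leaving only an arctangent and a logarithm to be estimated.\<close>

lemma sweeps_arctan:
  assumes z: "0 \<le> z" and h: "0 < h" "h\<^sup>2 = 1 + z\<^sup>2"
  shows "sweeps (2 * arctan z) z h (ln ((h + z) / (h - z)))"
proof -
  have r: "sqrt (1 + z\<^sup>2) = h" using h by (metis real_sqrt_unique less_imp_le)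
  have "z\<^sup>2 < h\<^sup>2" using h by simp
  then have "z < h" using h(1) by (simp add: power_less_imp_less_base)
  have "(1 + z / h) / (1 - z / h) = (h + z) / (h - z)"
    using h(1) \<open>z < h\<close> by (simp add: field_simps)
  then show ?thesis
    using sweeps_radial[of "arctan z"] z arctan_ubound[of z]
    by (simp add: tan_arctan cos_arctan sin_arctan r)
qed

text \<open>The difference of the two sides has derivative \<open>u ^ 8 / (1 + u\<^sup>2)\<close>.
  The bound certifies that the listed angles cover a whole sector.\<close>

lemma arctan_ge_taylor:
  assumes "0 \<le> x" shows "x - x ^ 3 / 3 + x ^ 5 / 5 - x ^ 7 / 7 \<le> arctan x"
proof -
  let ?p = "\<lambda>x::real. x - x ^ 3 / 3 + x ^ 5 / 5 - x ^ 7 / 7"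
  have "arctan 0 - ?p 0 \<le> arctan x - ?p x"
  proof (rule DERIV_nonneg_imp_nondecreasing[OF assms])
    fix u :: real
    let ?q = "1 - u\<^sup>2 + u ^ 4 - u ^ 6"
    have "((\<lambda>x. arctan x - ?p x) has_real_derivative (inverse (1 + u\<^sup>2) - ?q)) (at u)"
      by (auto intro!: derivative_eq_intros)
    moreover have "?q \<le> inverse (1 + u\<^sup>2)"
    proof -
      have "?q * (1 + u\<^sup>2) = 1 - u ^ 8" by algebra
      then have "?q * (1 + u\<^sup>2) \<le> 1" by simp
      moreover have "0 < 1 + u\<^sup>2" by (simp add: add_pos_nonneg)
      ultimately show ?thesis by (simp add: inverse_eq_divide pos_le_divide_eq)
    qed
    ultimately show "\<exists>D. ((\<lambda>x. arctan x - ?p x) has_real_derivative D) (at u) \<and> 0 \<le> D"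
      by (intro exI[of _ "inverse (1 + u\<^sup>2) - ?q"]) auto
  qed
  then show ?thesis by simp
qed

lemma ln_13_7: "ln (13 / 7 :: real) \<le> 0.61905"
  using ln_approx_bounds[of "13 / 7" 3] by (simp add: eval_nat_numeral)

lemma ln_5_2: "ln (5 / 2 :: real) \<le> 0.9164"
  using ln_approx_bounds[of "5 / 2" 4] by (simp add: eval_nat_numeral)

text \<open>The following values come from numerically minimising the total cost, which is convex in the
  distances \<open>y'\<close>, with the speeds \<open>w\<close> and \<open>w'\<close> rounded up. The opening half-angles
  \<open>arctan (60 / 91)\<close> and \<open>arctan (21 / 20)\<close> are near-optimal ones with rational sine and cosine.\<close>

definition sweep1 :: "(real \<times> real \<times> real \<times> real) list" where
  "sweep1 =
   [(0.11, 0.464, 2.8531, 2.8144),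
    (0.13, 0.341, 2.0008, 1.9759),
    (0.21, 0.259, 1.4317, 1.4144),
    (0.85, 0.264, 1.0274, 1.0286),
    (0.52, 0.311, 0.9472, 0.9614),
    (0.42, 0.367, 0.9208, 0.9412),
    (0.37, 0.433, 0.8999, 0.9288),
    (0.34, 0.51, 0.8865, 0.9266),
    (0.32, 0.6, 0.8814, 0.9363),
    (0.31, 0.705, 0.893, 0.9667),
    (0.32, 0.833, 0.9258, 1.0266),
    (0.34, 0.998, 0.9792, 1.123),
    (0.37, 1.221, 1.0742, 1.2841),
    (0.5074, 1.614, 1.2417, 1.6297)]"

definition sweep2 :: "(real \<times> real \<times> real \<times> real) list" where
  "sweep2 =
   [(0.24, 1.086, 1.351, 1.3791),
    (0.26, 1.163, 1.2942, 1.3595),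
    (0.28, 1.284, 1.2943, 1.404),
    (0.3, 1.458, 1.351, 1.5173),
    (0.4421, 1.798, 1.4762, 1.8128)]"

lemma sweep1_ok: "sweep_ok (60 / 91) sweep1"
  by (simp add: sweep1_def power2_eq_square)

lemma sweep2_ok: "sweep_ok (21 / 20) sweep2"
  by (simp add: sweep2_def power2_eq_square)

lemma sweep1_cost: "sweep_cost (109 / 91) sweep1 \<le> 21.0702"
  by (simp add: sweep1_def power2_eq_square)

lemma sweep2_cost: "sweep_cost (29 / 20) sweep2 \<le> 3.8046"
  by (simp add: sweep2_def power2_eq_square)

theorem theorem3:
  fixes n :: nat
  assumes "n \<ge> 1"
  shows "\<exists>T. trajectories n T \<and> feasible n T
           \<and> (\<lambda>t. insp n T (bpoint t)) integrable_on {0..2 * pi}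
           \<and> (n = 1 \<longrightarrow> avg_insp n T \<le> 3.5509015)
           \<and> (n = 2 \<longrightarrow> avg_insp n T \<le> 1.7946051)
           \<and> (n \<ge> 3 \<longrightarrow> avg_insp n T \<le>
                real n / (2 * pi) * ln ((1 + sin (pi / real n)) / (1 - sin (pi / real n))))"
proof -
  consider "n = 1" | "n = 2" | "n \<ge> 3" using assms by linarith
  then show ?thesis
  proof cases
    case 1
    \<comment> \<open>Halving the angle gives a small rational argument, where the Taylor bound is
      sharp enough.\<close>
    have "arctan (60 / 91) = 2 * arctan (3 / 10)"
      by (subst arctan_double) (simp_all add: power2_eq_square)
    then have t: "2 * pi / real n \<le> 2 * arctan (60 / 91) + sum_list (map fst sweep1)"
      using arctan_ge_taylor[of "3 / 10"] pi_approx(2)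
      by (simp add: 1 sweep1_def power_divide)
    \<comment> \<open>The fraction is \<open>(109 + 60) / (109 - 60)\<close>, a square, which
      reduces the logarithm to a smaller argument.\<close>
    have c: "ln (169 / 49) = 2 * ln (13 / 7 :: real)"
      using ln_realpow[of "13 / 7 :: real" 2] by (simp add: power2_eq_square)
    have "sweeps (2 * arctan (60 / 91)) (60 / 91) (109 / 91) (ln (169 / 49))"
      using sweeps_arctan[of "60 / 91" "109 / 91"] by (simp add: power2_eq_square)
    then obtain y s where "sweeps (2 * arctan (60 / 91) + sum_list (map fst sweep1)) y s
        (ln (169 / 49) + sweep_cost (109 / 91) sweep1)"
      using sweeps_list[OF _ sweep1_ok] by blast
    from sweeps_trajectories[OF assms t this] obtain T where T: "trajectories n T" "feasible n T"
      "(\<lambda>t. insp n T (bpoint t)) integrable_on {0..2 * pi}"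
      "avg_insp n T \<le> 1 / (2 * pi) * (ln (169 / 49) + sweep_cost (109 / 91) sweep1)"
      unfolding 1 by auto
    have "ln (169 / 49) + sweep_cost (109 / 91) sweep1 \<le> 3.5509015 * (2 * pi)"
      using c ln_13_7 sweep1_cost pi_approx(1) by simp
    then have "1 / (2 * pi) * (ln (169 / 49) + sweep_cost (109 / 91) sweep1) \<le> 3.5509015"
      by (simp add: pos_divide_le_eq)
    with T(4) have "avg_insp n T \<le> 3.5509015" by (rule order_trans)
    then show ?thesis using T(1-3) 1 by (intro exI[of _ T]) simp
  next
    case 2
    \<comment> \<open>As \<open>21 / 20 = (1 + 1 / 41) / (1 - 1 / 41)\<close>, splitting off
      \<open>pi / 4\<close> leaves a tiny argument for the Taylor bound.\<close>
    have "arctan (21 / 20) = pi / 4 + arctan (1 / 41)"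
      using arctan_add[of 1 "1 / 41"] by (simp add: arctan_one)
    then have t: "2 * pi / real n \<le> 2 * arctan (21 / 20) + sum_list (map fst sweep2)"
      using arctan_ge_taylor[of "1 / 41"] pi_approx(2)
      by (simp add: 2 sweep2_def power_divide)
    have c: "ln (25 / 4) = 2 * ln (5 / 2 :: real)"
      using ln_realpow[of "5 / 2 :: real" 2] by (simp add: power2_eq_square)
    have "sweeps (2 * arctan (21 / 20)) (21 / 20) (29 / 20) (ln (25 / 4))"
      using sweeps_arctan[of "21 / 20" "29 / 20"] by (simp add: power2_eq_square)
    then obtain y s where "sweeps (2 * arctan (21 / 20) + sum_list (map fst sweep2)) y s
        (ln (25 / 4) + sweep_cost (29 / 20) sweep2)"
      using sweeps_list[OF _ sweep2_ok] by blast
    from sweeps_trajectories[OF assms t this] obtain T where T: "trajectories n T" "feasible n T"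
      "(\<lambda>t. insp n T (bpoint t)) integrable_on {0..2 * pi}"
      "avg_insp n T \<le> 1 / pi * (ln (25 / 4) + sweep_cost (29 / 20) sweep2)"
      unfolding 2 by auto
    have "ln (25 / 4) + sweep_cost (29 / 20) sweep2 \<le> 1.7946051 * pi"
      using c ln_5_2 sweep2_cost pi_approx(1) by simp
    then have "1 / pi * (ln (25 / 4) + sweep_cost (29 / 20) sweep2) \<le> 1.7946051"
      by (simp add: pos_divide_le_eq)
    with T(4) have "avg_insp n T \<le> 1.7946051" by (rule order_trans)
    then show ?thesis using T(1-3) 2 by (intro exI[of _ T]) simp
  next
    case 3
    \<comment> \<open>Half a sector is now less than a right angle, so the radial motion alone
      inspects the whole sector.\<close>
    have "pi / real n < pi / 2" using 3 by (intro divide_strict_left_mono) auto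
    then have "sweeps (2 * (pi / real n)) (tan (pi / real n)) (1 / cos (pi / real n))
        (ln ((1 + sin (pi / real n)) / (1 - sin (pi / real n))))"
      by (intro sweeps_radial) auto
    from sweeps_trajectories[OF assms _ this] 3 show ?thesis by auto
  qed
qed

end
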